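(* Let $P=(p_1,\dots,p_n)$ be a real pattern with break regions $[l_k,r_k]$ ($1\le k\le b-1$) and thresholds $\varepsilon_1,\dots,\varepsilon_b\ge 0$, let $S=(S_1,S_2,\dots)$ be a real sequence, let $w$ be an integer with $1\le w\le n$, and let $N=\lfloor n/w\rfloor$. For $1\le k\le b$ put $md(k)=\varepsilon_k\sqrt{r_k-l_{k-1}}$. For $w\le i\le n$ let $i'=i-w+1$, let $\mu_{P[i':i]}$ be the mean of $p_{i'},\dots,p_i$, let $k_l$ and $k_r$ be the smallest and the largest $k\in\{1,\dots,b\}$ such that the interval $[i',i]$ contains an integer of $(l_{k-1},r_k]$ (i.e. an index that may belong to the $k$-th segment), and define $$\theta_{seq}(i)=\sqrt{\frac1w\sum_{k=k_l}^{k_r}md(k)^2},\qquad U_i=\mu_{P[i':i]}+\theta_{seq}(i),\qquad L_i=\mu_{P[i':i]}-\theta_{seq}(i).$$ For $2\le j\le N$ define $$\hat P^u_j=\max_{0\le i<w}U_{jw-i},\qquad \hat P^l_j=\min_{0\le i<w}L_{jw-i},\qquad \hat W^f_{t,j}=\frac1w\sum_{m=(j-1)w+1}^{jw}s_{t,m}.$$ Then the subsequence-based equal-length block representation satisfies the lower bounding property: for every $t\ge1$, if there exists $i\in\{0,1,\dots,w-1\}$ such that the window $W_{t+i}$ is a fine-grained matching result of $P$, then for all $j\in\{2,\dots,N\}$, $$\hat P^l_j\le \hat W^f_{t,j}\le \hat P^u_j .$$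
   Context: For equal-length real sequences, $ED_{norm}(X,Y)=\sqrt{\frac1m\sum_{i=1}^m|x_i-y_i|^2}$, where $m$ is their common length. $X[i:j]$ denotes $(x_i,\dots,x_j)$. Break regions: the number of segments is $b\ge1$; $[l_k,r_k]$, $1\le k\le b-1$, are integer intervals that are pairwise non-overlapping and ordered, contained in $[1,n-1]$, i.e. $1\le l_1\le r_1<l_2\le r_2<\dots<l_{b-1}\le r_{b-1}\le n-1$. By convention $l_0=r_0=0$ and $l_b=r_b=n$. A segmentation is a choice of integers (breakpoints) $bp_k\in[l_k,r_k]$ for $1\le k\le b-1$, with $bp_0=0$ and $bp_b=n$. The sliding window starting at $t$ is $W_t=(s_{t,1},\dots,s_{t,n})$ with $s_{t,i}=S_{t+i-1}$. $W_t$ is a fine-grained matching result of $P$ if there exists a segmentation such that for every $k\in\{1,\dots,b\}$, $$ED_{norm}\big(P[bp_{k-1}+1:bp_k],\,W_t[bp_{k-1}+1:bp_k]\big)\le\varepsilon_k.$$ *)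

theory Defs
  imports Complex_Main
begin

text \<open>
  Sequences (the pattern, the stream, a window) are functions on \<^typ>\<open>nat\<close> indexed from 1, as in
  the paper; a pattern or window of length \<open>n\<close> is only ever read at the indices \<open>1, \<dots>, n\<close>.
\<close>

definition subseq_of :: "(nat \<Rightarrow> real) \<Rightarrow> nat \<Rightarrow> nat \<Rightarrow> real list" where
  "subseq_of X i j = map X [i..<Suc j]"

text \<open>Only meaningful for lists of equal length.\<close>

definition ED_norm :: "real list \<Rightarrow> real list \<Rightarrow> real" where
  "ED_norm X Y =
     sqrt (1 / real (length X) * (\<Sum>i<length X. \<bar>X ! i - Y ! i\<bar> ^ 2))"

definition mean :: "real list \<Rightarrow> real" where
  "mean X = sum_list X / real (length X)"

text \<open>The first conjuncts encode the conventions for the virtual regions \<open>0\<close> and \<open>b\<close>.\<close>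

definition break_regions :: "nat \<Rightarrow> nat \<Rightarrow> (nat \<Rightarrow> nat) \<Rightarrow> (nat \<Rightarrow> nat) \<Rightarrow> bool" where
  "break_regions n b l r \<longleftrightarrow>
     l 0 = 0 \<and> r 0 = 0 \<and> l b = n \<and> r b = n \<and>
     (\<forall>k. 1 \<le> k \<and> k \<le> b - 1 \<longrightarrow> 1 \<le> l k \<and> l k \<le> r k \<and> r k \<le> n - 1) \<and>
     (\<forall>k. 1 \<le> k \<and> k + 1 \<le> b - 1 \<longrightarrow> r k < l (k + 1))"

definition segmentation ::
  "nat \<Rightarrow> nat \<Rightarrow> (nat \<Rightarrow> nat) \<Rightarrow> (nat \<Rightarrow> nat) \<Rightarrow> (nat \<Rightarrow> nat) \<Rightarrow> bool" where
  "segmentation n b l r bp \<longleftrightarrow>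
     bp 0 = 0 \<and> bp b = n \<and>
     (\<forall>k. 1 \<le> k \<and> k \<le> b - 1 \<longrightarrow> l k \<le> bp k \<and> bp k \<le> r k)"

definition window :: "(nat \<Rightarrow> real) \<Rightarrow> nat \<Rightarrow> nat \<Rightarrow> real" where
  "window S t i = S (t + i - 1)"

definition fine_grained_match ::
  "nat \<Rightarrow> nat \<Rightarrow> (nat \<Rightarrow> nat) \<Rightarrow> (nat \<Rightarrow> nat) \<Rightarrow> (nat \<Rightarrow> real) \<Rightarrow> (nat \<Rightarrow> real) \<Rightarrow> (nat \<Rightarrow> real) \<Rightarrow> bool" where
  "fine_grained_match n b l r \<epsilon> P W \<longleftrightarrow>
     (\<exists>bp. segmentation n b l r bp \<and>
       (\<forall>k\<in>{1..b}. ED_norm (subseq_of P (bp (k - 1) + 1) (bp k))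
                            (subseq_of W (bp (k - 1) + 1) (bp k)) \<le> \<epsilon> k))"

definition md :: "(nat \<Rightarrow> nat) \<Rightarrow> (nat \<Rightarrow> nat) \<Rightarrow> (nat \<Rightarrow> real) \<Rightarrow> nat \<Rightarrow> real" where
  "md l r \<epsilon> k = \<epsilon> k * sqrt (real (r k) - real (l (k - 1)))"

text \<open>
  Below, \<open>i' = i - w + 1\<close> is written \<open>i + 1 - w\<close>, which is exact on \<^typ>\<open>nat\<close> for \<open>w \<le> i\<close>.
  The set of segments is finite, and nonempty whenever \<open>w \<le> i \<le> n\<close>, so that its minimum and
  maximum exist.
\<close>

definition touching_segments ::
  "nat \<Rightarrow> (nat \<Rightarrow> nat) \<Rightarrow> (nat \<Rightarrow> nat) \<Rightarrow> nat \<Rightarrow> nat \<Rightarrow> nat set" where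
  "touching_segments b l r w i =
     {k \<in> {1..b}. {i + 1 - w..i} \<inter> {l (k - 1)<..r k} \<noteq> {}}"

definition theta_seg ::
  "nat \<Rightarrow> (nat \<Rightarrow> nat) \<Rightarrow> (nat \<Rightarrow> nat) \<Rightarrow> (nat \<Rightarrow> real) \<Rightarrow> nat \<Rightarrow> nat \<Rightarrow> real" where
  "theta_seg b l r \<epsilon> w i =
     sqrt (1 / real w *
       (\<Sum>k = Min (touching_segments b l r w i)..Max (touching_segments b l r w i).
          md l r \<epsilon> k ^ 2))"

definition upper_env ::
  "nat \<Rightarrow> (nat \<Rightarrow> nat) \<Rightarrow> (nat \<Rightarrow> nat) \<Rightarrow> (nat \<Rightarrow> real) \<Rightarrow> (nat \<Rightarrow> real) \<Rightarrow> nat \<Rightarrow> nat \<Rightarrow> real" where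
  "upper_env b l r \<epsilon> P w i = mean (subseq_of P (i + 1 - w) i) + theta_seg b l r \<epsilon> w i"

definition lower_env ::
  "nat \<Rightarrow> (nat \<Rightarrow> nat) \<Rightarrow> (nat \<Rightarrow> nat) \<Rightarrow> (nat \<Rightarrow> real) \<Rightarrow> (nat \<Rightarrow> real) \<Rightarrow> nat \<Rightarrow> nat \<Rightarrow> real" where
  "lower_env b l r \<epsilon> P w i = mean (subseq_of P (i + 1 - w) i) - theta_seg b l r \<epsilon> w i"

text \<open>The block features of the pattern are only used for \<open>j \<ge> 2\<close>, where \<open>w \<le> j * w - i\<close>.\<close>

definition block_upper ::
  "nat \<Rightarrow> (nat \<Rightarrow> nat) \<Rightarrow> (nat \<Rightarrow> nat) \<Rightarrow> (nat \<Rightarrow> real) \<Rightarrow> (nat \<Rightarrow> real) \<Rightarrow> nat \<Rightarrow> nat \<Rightarrow> real" where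
  "block_upper b l r \<epsilon> P w j = Max ((\<lambda>i. upper_env b l r \<epsilon> P w (j * w - i)) ` {0..<w})"

definition block_lower ::
  "nat \<Rightarrow> (nat \<Rightarrow> nat) \<Rightarrow> (nat \<Rightarrow> nat) \<Rightarrow> (nat \<Rightarrow> real) \<Rightarrow> (nat \<Rightarrow> real) \<Rightarrow> nat \<Rightarrow> nat \<Rightarrow> real" where
  "block_lower b l r \<epsilon> P w j = Min ((\<lambda>i. lower_env b l r \<epsilon> P w (j * w - i)) ` {0..<w})"

definition block_feature :: "(nat \<Rightarrow> real) \<Rightarrow> nat \<Rightarrow> nat \<Rightarrow> real" where
  "block_feature W w j = 1 / real w * (\<Sum>m = (j - 1) * w + 1..j * w. W m)"

end

theory Submission
  imports Defs "HOL-Analysis.Convex"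
begin

text \<open>
  If \<open>W\<^bsub>t+i\<^esub>\<close> matches, then block \<open>j\<close> of \<open>W\<^sub>t\<close> consists of the entries of \<open>W\<^bsub>t+i\<^esub>\<close>
  at the \<open>w\<close> positions ending at \<open>e = j w - i\<close>. By the Cauchy--Schwarz inequality the squared
  difference between its mean and that of \<open>P\<close> at these positions is at most \<open>1/w\<close> times the
  sum of the squared deviations. Each position belongs to one of the segments met by the block, and
  the squared deviations over the whole of segment \<open>k\<close> sum to at most
  \<open>\<epsilon>\<^sub>k\<^sup>2 (bp\<^sub>k - bp\<^bsub>k-1\<^esub>) \<le> md(k)\<^sup>2\<close>.
\<close>

lemma mean_subseq_of:
  "mean (subseq_of X i j) = (\<Sum>x\<in>{i..j}. X x) / real (Suc j - i)"
  by (simp add: mean_def subseq_of_def interv_sum_list_conv_sum_set_nat atLeastLessThanSuc_atLeastAtMost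
      del: upt_Suc)

lemma ED_norm_subseq_of:
  "ED_norm (subseq_of X (a + 1) c) (subseq_of Y (a + 1) c) =
     sqrt (1 / real (c - a) * (\<Sum>x\<in>{a<..c}. (X x - Y x)\<^sup>2))"
proof -
  have "(\<Sum>i<c - a. \<bar>map X [a + 1..<Suc c] ! i - map Y [a + 1..<Suc c] ! i\<bar> ^ 2)
      = (\<Sum>i<c - a. (X (a + 1 + i) - Y (a + 1 + i))\<^sup>2)"
    by (intro sum.cong refl) (simp add: nth_append del: upt_Suc)
  also have "\<dots> = (\<Sum>x\<in>{a<..c}. (X x - Y x)\<^sup>2)"
    by (rule sum.reindex_bij_witness[where i = "\<lambda>x. x - a - 1" and j = "\<lambda>i. a + 1 + i"]) auto
  finally show ?thesis
    by (simp add: ED_norm_def subseq_of_def del: upt_Suc)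
qed

lemma abs_mean_subseq_of_diff_le:
  assumes "1 \<le> w" "w \<le> e"
    and "(\<Sum>x\<in>{e + 1 - w..e}. (X x - Y x)\<^sup>2) \<le> C"
  shows "\<bar>mean (subseq_of X (e + 1 - w) e) - mean (subseq_of Y (e + 1 - w) e)\<bar> \<le> sqrt (1 / real w * C)"
proof -
  let ?A = "{e + 1 - w..e}"
  let ?D = "mean (subseq_of X (e + 1 - w) e) - mean (subseq_of Y (e + 1 - w) e)"
  have card: "Suc e - (e + 1 - w) = w" using assms by simp
  have D: "?D = (\<Sum>x\<in>?A. X x - Y x) / real w"
    unfolding mean_subseq_of card by (simp add: sum_subtractf diff_divide_distrib)
  \<comment> \<open>Cauchy-Schwarz against the constant 1 costs a factor \<open>w\<close>; dividing
    the mean by \<open>w\<close> twice leaves \<open>1 / w\<close>.\<close>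
  have "(\<Sum>x\<in>?A. X x - Y x)\<^sup>2 \<le> (\<Sum>x\<in>?A. (X x - Y x)\<^sup>2) * real (card ?A)"
    by (rule sum_squared_le_sum_of_squares)
  also have "\<dots> \<le> C * real w"
    using assms(3) card by (simp add: mult_right_mono)
  finally have "?D\<^sup>2 \<le> 1 / real w * C"
    using assms(1) unfolding D by (simp add: field_simps power2_eq_square)
  then show ?thesis
    using real_le_rsqrt[of "\<bar>?D\<bar>"] by simp
qed

text \<open>The conventions for the virtual regions \<open>0\<close> and \<open>b\<close> extend the
  bounds to the two ends, so that both ends of every segment are covered.\<close>

lemma segmentation_bounds:
  assumes "break_regions n b l r" "segmentation n b l r bp" "k \<le> b"
  shows "l k \<le> bp k" "bp k \<le> r k"
proof -
  consider "k = 0" | "k = b" | "1 \<le> k" "k \<le> b - 1"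
    using assms(3) by linarith
  then show "l k \<le> bp k" "bp k \<le> r k"
    using assms(1,2) by (cases; auto simp: break_regions_def segmentation_def)+
qed

text \<open>The first breakpoint that reaches \<open>x\<close> closes its segment: by minimality the
  preceding breakpoint lies below \<open>x\<close>.\<close>

lemma segmentation_covers:
  assumes "segmentation n b l r bp" "1 \<le> x" "x \<le> n"
  shows "\<exists>k\<in>{1..b}. x \<in> {bp (k - 1)<..bp k}"
proof -
  define k where "k = (LEAST k. x \<le> bp k)"
  have b: "x \<le> bp b" and z: "bp 0 = 0"
    using assms by (auto simp: segmentation_def)
  have k: "x \<le> bp k" "k \<le> b"
    unfolding k_def using b by (auto intro: LeastI Least_le)
  \<comment> \<open>Since \<open>bp 0 = 0 < x\<close>, the index \<open>k - 1\<close> is a genuine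
    predecessor.\<close>
  then have "0 < k"
    using z assms(2) by (cases k) auto
  then have "\<not> x \<le> bp (k - 1)"
    using not_less_Least[of "k - 1" "\<lambda>k. x \<le> bp k"] by (simp add: k_def)
  with k \<open>0 < k\<close> show ?thesis by (intro bexI[of _ k]) auto
qed

lemma segment_deviation_le_md:
  assumes "ED_norm (subseq_of X (a + 1) c) (subseq_of Y (a + 1) c) \<le> \<epsilon> k"
    and "l (k - 1) \<le> a" "c \<le> r k"
  shows "(\<Sum>x\<in>{a<..c}. (X x - Y x)\<^sup>2) \<le> (md l r \<epsilon> k)\<^sup>2"
\<comment> \<open>The length \<open>c - a\<close> has to be positive to clear the denominator;
  otherwise the sum is empty and the bound is a square.\<close>
proof (cases "a < c")
  case True
  let ?s = "\<Sum>x\<in>{a<..c}. (X x - Y x)\<^sup>2"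
  have "?s / real (c - a) \<le> (\<epsilon> k)\<^sup>2"
    using assms(1) unfolding ED_norm_subseq_of by (auto dest: sqrt_le_D)
  then have "?s \<le> (\<epsilon> k)\<^sup>2 * real (c - a)"
    using True by (simp add: field_simps)
  also have "\<dots> \<le> (\<epsilon> k)\<^sup>2 * (real (r k) - real (l (k - 1)))"
    using assms(2,3) True by (intro mult_left_mono) auto
  also have "\<dots> = (md l r \<epsilon> k)\<^sup>2"
    using assms(2,3) True by (simp add: md_def power_mult_distrib)
  finally show ?thesis .
qed simp

lemma sum_deviation_le_sum_md:
  assumes br: "break_regions n b l r" and fg: "fine_grained_match n b l r \<epsilon> P W"
    and A: "1 \<le> i + 1 - w" "i \<le> n"
  defines "T \<equiv> touching_segments b l r w i"
  shows "(\<Sum>x\<in>{i + 1 - w..i}. (P x - W x)\<^sup>2) \<le> (\<Sum>k=Min T..Max T. (md l r \<epsilon> k)\<^sup>2)"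
proof -
  let ?A = "{i + 1 - w..i}"
  obtain bp where bp: "segmentation n b l r bp"
    and ed: "\<And>k. k \<in> {1..b} \<Longrightarrow> ED_norm (subseq_of P (bp (k - 1) + 1) (bp k))
                            (subseq_of W (bp (k - 1) + 1) (bp k)) \<le> \<epsilon> k"
    using fg by (auto simp: fine_grained_match_def)
  have bounds: "l (k - 1) \<le> bp (k - 1)" "bp k \<le> r k" if "k \<in> {1..b}" for k
    using segmentation_bounds[OF br bp] that by auto
  have "\<forall>x\<in>?A. \<exists>k\<in>{1..b}. x \<in> {bp (k - 1)<..bp k}"
    using segmentation_covers[OF bp] A by auto
  then obtain \<kappa> where \<kappa>: "\<And>x. x \<in> ?A \<Longrightarrow> \<kappa> x \<in> {1..b} \<and> x \<in> {bp (\<kappa> x - 1)<..bp (\<kappa> x)}"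
    by metis
  have T: "T \<subseteq> {1..b}"
    by (auto simp: T_def touching_segments_def)
  then have fin: "finite T"
    by (rule finite_subset) simp
  \<comment> \<open>The actual segment lies inside its largest possible extent, so the position
    \<open>x\<close> itself witnesses the intersection.\<close>
  have "\<kappa> x \<in> T" if x: "x \<in> ?A" for x
  proof -
    have "x \<in> ?A \<inter> {l (\<kappa> x - 1)<..r (\<kappa> x)}"
      using x \<kappa>[OF x] bounds[of "\<kappa> x"] by auto
    then show ?thesis
      using \<kappa>[OF x] by (auto simp: T_def touching_segments_def)
  qed
  then have "(\<Sum>x\<in>?A. (P x - W x)\<^sup>2) = (\<Sum>k\<in>T. \<Sum>x\<in>{x\<in>?A. \<kappa> x = k}. (P x - W x)\<^sup>2)"
    by (intro sum.group[symmetric] fin) auto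
  also have "\<dots> \<le> (\<Sum>k\<in>T. (md l r \<epsilon> k)\<^sup>2)"
  proof (rule sum_mono)
    fix k assume "k \<in> T"
    then have k: "k \<in> {1..b}" using T by auto
    have "(\<Sum>x\<in>{x\<in>?A. \<kappa> x = k}. (P x - W x)\<^sup>2) \<le> (\<Sum>x\<in>{bp (k - 1)<..bp k}. (P x - W x)\<^sup>2)"
      using \<kappa> by (intro sum_mono2) auto
    also have "\<dots> \<le> (md l r \<epsilon> k)\<^sup>2"
      using ed[OF k] bounds[OF k] by (rule segment_deviation_le_md)
    finally show "(\<Sum>x\<in>{x\<in>?A. \<kappa> x = k}. (P x - W x)\<^sup>2) \<le> (md l r \<epsilon> k)\<^sup>2" .
  qed
  \<comment> \<open>Filling possible gaps in \<open>T\<close> only adds squares.\<close>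
  also have "\<dots> \<le> (\<Sum>k=Min T..Max T. (md l r \<epsilon> k)\<^sup>2)"
    using fin by (intro sum_mono2) auto
  finally show ?thesis .
qed

text \<open>Position \<open>m\<close> of the window at \<open>t\<close> and position
  \<open>m - i\<close> of the window at \<open>t + i\<close> read the same stream entry. As
  \<open>j \<ge> 2\<close> and \<open>i < w\<close>, every \<open>m\<close> in the block exceeds
  \<open>i\<close>, so the truncated subtraction is exact.\<close>

lemma block_feature_eq_mean_shifted_window:
  assumes "i < w" "2 \<le> j"
  shows "block_feature (window S t) w j
       = mean (subseq_of (window S (t + i)) (j * w - i + 1 - w) (j * w - i))"
proof -
  obtain j' where j: "j = Suc (Suc j')"
    using assms(2) by (metis add_2_eq_Suc le_iff_add)
  have "(\<Sum>m = (j - 1) * w + 1..j * w. window S t m)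
      = (\<Sum>x = j * w - i + 1 - w..j * w - i. window S (t + i) x)"
    by (rule sum.reindex_bij_witness[where i = "\<lambda>x. x + i" and j = "\<lambda>m. m - i"])
      (use assms(1) in \<open>auto simp: window_def j algebra_simps\<close>)
  moreover have "Suc (j * w - i) - (j * w - i + 1 - w) = w"
    using assms(1) by (simp add: j)
  ultimately show ?thesis
    unfolding block_feature_def mean_subseq_of by simp
qed

theorem mainTheorem2:
  fixes n b w :: nat
    and l r :: "nat \<Rightarrow> nat"
    and \<epsilon> P S :: "nat \<Rightarrow> real"
  assumes "b \<ge> 1"
    and "break_regions n b l r"
    and "\<forall>k\<in>{1..b}. \<epsilon> k \<ge> 0"
    and "1 \<le> w" and "w \<le> n"
  shows "\<forall>t\<ge>1. (\<exists>i\<in>{0..w - 1}. fine_grained_match n b l r \<epsilon> P (window S (t + i))) \<longrightarrow>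
           (\<forall>j\<in>{2..n div w}.
              block_lower b l r \<epsilon> P w j \<le> block_feature (window S t) w j \<and>
              block_feature (window S t) w j \<le> block_upper b l r \<epsilon> P w j)"
proof (intro allI impI ballI)
  fix t j
  assume "\<exists>i\<in>{0..w - 1}. fine_grained_match n b l r \<epsilon> P (window S (t + i))"
    and j: "j \<in> {2..n div w}"
  then obtain i where i: "i \<in> {0..<w}" and fg: "fine_grained_match n b l r \<epsilon> P (window S (t + i))"
    using \<open>1 \<le> w\<close> by (metis Suc_pred' atLeastLessThanSuc_atLeastAtMost less_eq_Suc_le One_nat_def)
  define e where "e = j * w - i"
  \<comment> \<open>With \<open>i < w\<close>, these keep the \<open>w\<close> shifted positions
    ending at \<open>e\<close> inside the pattern.\<close>
  have "2 * w \<le> j * w" "j * w \<le> n"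
    using j \<open>1 \<le> w\<close> by (auto simp: less_eq_div_iff_mult_less_eq)
  then have e: "w \<le> e" "e \<le> n"
    using i unfolding e_def atLeastLessThan_iff by linarith+
  have feature: "block_feature (window S t) w j = mean (subseq_of (window S (t + i)) (e + 1 - w) e)"
    using i j unfolding e_def by (intro block_feature_eq_mean_shifted_window) auto
  have "\<bar>mean (subseq_of P (e + 1 - w) e) - block_feature (window S t) w j\<bar> \<le> theta_seg b l r \<epsilon> w e"
    unfolding feature theta_seg_def
    using assms e by (intro abs_mean_subseq_of_diff_le sum_deviation_le_sum_md[OF assms(2) fg]) auto
  then have "lower_env b l r \<epsilon> P w e \<le> block_feature (window S t) w j"
    and "block_feature (window S t) w j \<le> upper_env b l r \<epsilon> P w e"
    by (auto simp: lower_env_def upper_env_def)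
  \<comment> \<open>The unknown shift \<open>i\<close> is one of those over which the block extrema
    are taken.\<close>
  moreover have "block_lower b l r \<epsilon> P w j \<le> lower_env b l r \<epsilon> P w e"
    unfolding block_lower_def e_def using i by (intro Min_le) auto
  moreover have "upper_env b l r \<epsilon> P w e \<le> block_upper b l r \<epsilon> P w j"
    unfolding block_upper_def e_def using i by (intro Max_ge) auto
  ultimately show "block_lower b l r \<epsilon> P w j \<le> block_feature (window S t) w j \<and>
      block_feature (window S t) w j \<le> block_upper b l r \<epsilon> P w j"
    by linarith
qed

end
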